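(* Let $V$ be a $p$-dimensional real inner product space, $\mathbf A=(A_1,\dots,A_q)\in\mathrm{End}(V)^q$, and let $T=(T_u:u\in\mathbb N(q))$ be the generalized Newton transformation of $\mathbf A$. Then for every $u\in\mathbb N(q)$: (GN1) $|u|\,\sigma_u=\sum_{\alpha}\mathrm{tr}(A_\alpha T_{\alpha_\flat(u)})$; (GN2) $\mathrm{tr}\,T_u=(p-|u|)\,\sigma_u$; (GN3) $\sum_{\alpha,\beta}\mathrm{tr}(A_\alpha A_\beta T_{\beta_\flat\alpha_\flat(u)})=-|u|\,\sigma_u+\sum_\alpha(\mathrm{tr}A_\alpha)\,\sigma_{\alpha_\flat(u)}$.
   Context: Greek indices run over $1,\dots,q$. $\mathbb N=\{0,1,2,\dots\}$, $\mathbb N(q)$ is the set of multi-indices $u=(u_1,\dots,u_q)$ with $u_\alpha\in\mathbb N$, $|u|=\sum_\alpha u_\alpha$; $\alpha_\flat(u)$ is $u$ with $u_\alpha$ decreased by $1$. $\sigma_u=\sigma_u(\mathbf A)$ is defined by $\det(1_V+t_1A_1+\dots+t_qA_q)=\sum_{|u|\le p}\sigma_u t_1^{u_1}\cdots t_q^{u_q}$, and $\sigma_u=0$ if $|u|>p$ or $u$ has a negative entry. The generalized Newton transformation of $\mathbf A$ is the unique family $(T_u)_{u\in\mathbb N(q)}$ of endomorphisms of $V$ such that for every $u\in\mathbb N(q)$ and every smooth curve $\mathbf A(\tau)$ in $\mathrm{End}(V)^q$ with $\mathbf A(0)=\mathbf A$, $\frac{d}{d\tau}|_{\tau=0}\sigma_u(\mathbf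 A(\tau))=\sum_{\alpha}\mathrm{tr}(A_\alpha'(0)T_{\alpha_\flat(u)})$, with $T_w:=0$ if $w$ has a negative entry. Explicitly, $T_u=\sum_{s=0}^{|u|}\sum_{\alpha_1,\dots,\alpha_s}(-1)^s\sigma_{(\alpha_1)_\flat\cdots(\alpha_s)_\flat(u)}A_{\alpha_1}\cdots A_{\alpha_s}$. *)

theory Defs
  imports "HOL-Analysis.Analysis"
begin

text \<open>
  \<open>V\<close> is the type \<^typ>\<open>'v::euclidean_space\<close>, so that \<open>p = DIM('v)\<close>; \<open>End(V)\<close> is
  \<^typ>\<open>'v \<Rightarrow>\<^sub>L 'v\<close>, since every linear map on a finite-dimensional space is bounded. The index
  range \<open>1, \<dots>, q\<close> is a finite type \<open>'q\<close>.
\<close>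

text \<open>
  The library has trace and determinant for matrices only. Below, \<open>f b \<bullet> c\<close> is the entry in row
  \<open>c\<close> and column \<open>b\<close> of the matrix of \<open>f\<close> in the orthonormal basis \<^term>\<open>Basis\<close>.
\<close>

definition endo_trace :: "('v::euclidean_space \<Rightarrow>\<^sub>L 'v) \<Rightarrow> real" where
  "endo_trace f = (\<Sum>b\<in>Basis. blinfun_apply f b \<bullet> b)"

definition endo_det :: "('v::euclidean_space \<Rightarrow>\<^sub>L 'v) \<Rightarrow> real" where
  "endo_det f =
    (\<Sum>\<pi> | \<pi> permutes (Basis :: 'v set).
       of_int (sign \<pi>) * (\<Prod>b\<in>Basis. blinfun_apply f b \<bullet> \<pi> b))"

text \<open>
  Multi-indices are integer-valued, because lowering an entry that is \<open>0\<close> must give \<open>-1\<close>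
  (natural subtraction would truncate); \<open>\<nat>(q)\<close> is the subset \<open>multi_indices\<close>.
\<close>

definition multi_indices :: "('q::finite \<Rightarrow> int) set" where
  "multi_indices = {u. \<forall>\<alpha>. 0 \<le> u \<alpha>}"

definition weight :: "('q::finite \<Rightarrow> int) \<Rightarrow> int" where
  "weight u = (\<Sum>\<alpha>\<in>UNIV. u \<alpha>)"

definition flat :: "'q \<Rightarrow> ('q::finite \<Rightarrow> int) \<Rightarrow> 'q \<Rightarrow> int" where
  "flat \<alpha> u = u(\<alpha> := u \<alpha> - 1)"

text \<open>
  The family of coefficients is determined by the polynomial function on \<open>\<real>\<^sup>q\<close>, hence \<open>THE\<close>.
\<close>

definition sigma ::
    "('v::euclidean_space \<Rightarrow>\<^sub>L 'v) ^ 'q::finite \<Rightarrow> ('q \<Rightarrow> int) \<Rightarrow> real" where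
  "sigma A = (THE s.
     (\<forall>u. u \<notin> multi_indices \<or> weight u > int DIM('v) \<longrightarrow> s u = 0) \<and>
     (\<forall>t :: 'q \<Rightarrow> real.
        endo_det (id_blinfun + (\<Sum>\<alpha>\<in>UNIV. t \<alpha> *\<^sub>R A $ \<alpha>)) =
        (\<Sum>u | u \<in> multi_indices \<and> weight u \<le> int DIM('v).
           s u * (\<Prod>\<alpha>\<in>UNIV. t \<alpha> ^ nat (u \<alpha>)))))"

text \<open>
  Smoothness (of class \<open>C\<^sup>\<infinity>\<close>) on an open set of parameters: all iterated derivatives exist. Since
  \<open>S\<close> is open, the values of the iterated derivatives outside \<open>S\<close> play no role.
\<close>

definition smooth_curve_on :: "real set \<Rightarrow> (real \<Rightarrow> 'b::real_normed_vector) \<Rightarrow> bool" where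
  "smooth_curve_on S c \<longleftrightarrow> open S \<and>
     (\<forall>n. \<forall>\<tau>\<in>S. ((\<lambda>f s. vector_derivative f (at s)) ^^ n) c differentiable (at \<tau>))"

definition is_newton_transformation ::
    "('v::euclidean_space \<Rightarrow>\<^sub>L 'v) ^ 'q::finite \<Rightarrow> (('q \<Rightarrow> int) \<Rightarrow> ('v \<Rightarrow>\<^sub>L 'v)) \<Rightarrow> bool" where
  "is_newton_transformation A T \<longleftrightarrow>
     (\<forall>w. w \<notin> multi_indices \<longrightarrow> T w = 0) \<and>
     (\<forall>u\<in>multi_indices. \<forall>\<epsilon>>0. \<forall>c :: real \<Rightarrow> ('v \<Rightarrow>\<^sub>L 'v) ^ 'q.
        smooth_curve_on {-\<epsilon><..<\<epsilon>} c \<and> c 0 = A \<longrightarrow>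
        ((\<lambda>\<tau>. sigma (c \<tau>) u) has_real_derivative
           (\<Sum>\<alpha>\<in>UNIV. endo_trace ((vector_derivative c (at 0) $ \<alpha>) o\<^sub>L T (flat \<alpha> u)))) (at 0))"

definition newton_transformation ::
    "('v::euclidean_space \<Rightarrow>\<^sub>L 'v) ^ 'q::finite \<Rightarrow> ('q \<Rightarrow> int) \<Rightarrow> ('v \<Rightarrow>\<^sub>L 'v)" where
  "newton_transformation A = (THE T. is_newton_transformation A T)"

end

theory Submission
  imports Defs
begin

text \<open>
  Write \<open>M(t) = 1 + \<Sum>\<alpha>. t\<^sub>\<alpha> A\<^sub>\<alpha>\<close> and \<open>D(t) = det M(t)\<close>, so that \<open>\<sigma>\<^sub>u\<close> is the coefficient of \<open>t\<^sup>u\<close> in \<open>D\<close>. The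
  whole proof rests on one observation: the Newton transformation has the adjugate of the pencil as
  its generating function, \<open>adj M(t) = \<Sum>u. T\<^sub>u t\<^sup>u\<close>. Indeed, by Jacobi's formula
  (\<open>jacobi_formula\<close>) moving \<open>A\<close> along a curve changes \<open>D(t)\<close> at the rate
  \<open>\<Sum>\<alpha>. t\<^sub>\<alpha> tr (A'\<^sub>\<alpha> adj M(t))\<close>, and the coefficient of \<open>t\<^sup>u\<close> on the right involves the coefficients of
  \<open>adj M\<close> at the lowered indices, which is the defining property of \<open>T\<close>
  (\<open>newton_family_is_newton_transformation\<close>). Affine curves that move a single \<open>A\<^sub>\<alpha>\<close> show that no other
  family has this property (\<open>is_newton_transformation_unique\<close>).

  The identities are then comparisons of coefficients. Differentiating \<open>D\<close> along the ray through \<open>t\<close>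
  gives Euler's relation \<open>tr ((M - 1) adj M) = \<Sum>u. |u| \<sigma>\<^sub>u t\<^sup>u\<close>, which is the first identity. From
  \<open>M adj M = D 1\<close> follows \<open>(M - 1) adj M = D 1 - adj M\<close>, that is, the recursion
  \<open>T\<^sub>u = \<sigma>\<^sub>u 1 - \<Sum>\<beta>. A\<^sub>\<beta> T(\<beta>\<flat>(u))\<close> (\<open>newton_family_recursion\<close>). Its trace, together with the first
  identity, is the second one; composing it with \<open>A\<^sub>\<alpha>\<close> at the index \<open>\<alpha>\<flat>(u)\<close>, taking traces and summing
  over \<open>\<alpha>\<close> gives the third.

  Polynomials are treated as functions of \<open>t\<close>. A coefficient is read off as a fixed finite linear
  combination of values (\<open>coefficient_at\<close>); hence it is unique, it commutes with linear maps, and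
  it commutes with differentiation in a parameter.
\<close>

section \<open>Reading off coefficients by interpolation\<close>

definition lagrange_basis :: "nat \<Rightarrow> nat \<Rightarrow> real poly" where
  "lagrange_basis N i = (\<Prod>m\<in>{..N} - {i}. smult (1 / (real i - real m)) [:- real m, 1:])"

lemma poly_lagrange_basis:
  assumes "i \<le> N" "k \<le> N"
  shows "poly (lagrange_basis N i) (real k) = (if k = i then 1 else 0)"
proof (cases "k = i")
  case True
  then show ?thesis
    unfolding lagrange_basis_def poly_prod
    by (auto intro!: prod.neutral simp: diff_divide_distrib[symmetric])
next
  case False
  then have "k \<in> {..N} - {i}" using assms by auto
  then have "\<exists>m\<in>{..N} - {i}. poly (smult (1 / (real i - real m)) [:- real m, 1:]) (real k) = 0"
    by (intro bexI[of _ k]) auto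
  then show ?thesis
    unfolding lagrange_basis_def poly_prod using False by (auto intro!: prod_zero)
qed

lemma degree_lagrange_basis:
  assumes "i \<le> N"
  shows "degree (lagrange_basis N i) \<le> N"
proof -
  have "degree (lagrange_basis N i)
      \<le> (\<Sum>m\<in>{..N} - {i}. degree (smult (1 / (real i - real m)) [:- real m, 1:]))"
    unfolding lagrange_basis_def by (rule order.trans[OF degree_prod_sum_le]) (simp_all add: o_def)
  also have "\<dots> \<le> (\<Sum>m\<in>{..N} - {i}. 1)"
    by (intro sum_mono order.trans[OF degree_smult_le]) simp
  also have "\<dots> = N" using assms by simp
  finally show ?thesis .
qed

text \<open>
  Interpolation at \<open>0, \<dots>, N\<close> reproduces \<open>x\<^sup>j\<close>. Comparing coefficients of \<open>x\<^sup>k\<close> turns the coefficients of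
  the Lagrange basis into weights that extract the \<open>k\<close>-th coefficient from values.
\<close>

lemma sum_coeff_lagrange_basis:
  assumes "j \<le> N"
  shows "(\<Sum>i\<le>N. coeff (lagrange_basis N i) k * real i ^ j) = (if j = k then 1 else 0)"
proof -
  have "(\<Sum>i\<le>N. smult (real i ^ j) (lagrange_basis N i)) = monom 1 j"
  proof (rule poly_eqI_degree[of "real ` {..N}"])
    fix x assume "x \<in> real ` {..N}"
    then obtain n where n: "n \<le> N" "x = real n" by auto
    have "(\<Sum>i\<le>N. real i ^ j * poly (lagrange_basis N i) (real n))
        = (\<Sum>i\<le>N. if n = i then real i ^ j else 0)"
      by (intro sum.cong) (use n in \<open>auto simp: poly_lagrange_basis\<close>)
    then show "poly (\<Sum>i\<le>N. smult (real i ^ j) (lagrange_basis N i)) x = poly (monom 1 j) x"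
      using n by (simp add: poly_sum poly_monom)
  next
    have c: "card (real ` {..N}) = Suc N" by (simp add: card_image)
    have "degree (\<Sum>i\<le>N. smult (real i ^ j) (lagrange_basis N i)) \<le> N"
      by (intro degree_sum_le order.trans[OF degree_smult_le degree_lagrange_basis]) auto
    then show "degree (\<Sum>i\<le>N. smult (real i ^ j) (lagrange_basis N i)) < card (real ` {..N})"
      using c by simp
    show "degree (monom (1::real) j) < card (real ` {..N})"
      using c assms degree_monom_le[of "1::real" j] by linarith
  qed
  then have "coeff (\<Sum>i\<le>N. smult (real i ^ j) (lagrange_basis N i)) k = coeff (monom 1 j) k"
    by simp
  then show ?thesis by (simp add: coeff_sum mult.commute)
qed

definition monomial :: "('q::finite \<Rightarrow> real) \<Rightarrow> ('q \<Rightarrow> int) \<Rightarrow> real" where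
  "monomial t u = (\<Prod>\<alpha>\<in>UNIV. t \<alpha> ^ nat (u \<alpha>))"

definition multi_indices_upto :: "nat \<Rightarrow> ('q::finite \<Rightarrow> int) set" where
  "multi_indices_upto N = {u \<in> multi_indices. weight u \<le> int N}"

text \<open>
  The tensor product of the univariate weights, on the grid \<open>{0, \<dots>, N}\<^sup>q\<close>. On polynomials of total
  degree at most \<open>N\<close> it returns the coefficient of \<open>t\<^sup>u\<close>. An index with a negative entry must give
  \<open>0\<close>, so that lowering an index corresponds to multiplication by a coordinate without exceptions.
\<close>

definition coefficient_at ::
    "nat \<Rightarrow> ('q::finite \<Rightarrow> int) \<Rightarrow> (('q \<Rightarrow> real) \<Rightarrow> 'b) \<Rightarrow> 'b::real_normed_vector" where
  "coefficient_at N u f =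
     (if u \<in> multi_indices then
       (\<Sum>g\<in>PiE UNIV (\<lambda>_. {..N}).
          (\<Prod>\<alpha>\<in>UNIV. coeff (lagrange_basis N (g \<alpha>)) (nat (u \<alpha>))) *\<^sub>R f (\<lambda>\<alpha>. real (g \<alpha>)))
      else 0)"

lemma multi_index_le_weight:
  assumes "u \<in> multi_indices"
  shows "u \<alpha> \<le> weight u"
  using assms unfolding weight_def multi_indices_def
  by (intro member_le_sum) auto

lemma weight_nonneg: "u \<in> multi_indices \<Longrightarrow> 0 \<le> weight u"
  unfolding weight_def multi_indices_def by (auto intro: sum_nonneg)

lemma finite_multi_indices_upto [simp]: "finite (multi_indices_upto N)"
proof (rule finite_subset)
  show "multi_indices_upto N \<subseteq> PiE UNIV (\<lambda>_. {0..int N})"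
    using order.trans[OF multi_index_le_weight]
    by (auto simp: multi_indices_upto_def multi_indices_def)
qed (auto intro: finite_PiE)

lemma coefficient_at_monomial:
  assumes v: "v \<in> multi_indices_upto N"
  shows "coefficient_at N u (\<lambda>t. monomial t v *\<^sub>R x) = (if u = v then x else 0)"
proof (cases "u \<in> multi_indices")
  case False
  then show ?thesis using v by (auto simp: coefficient_at_def multi_indices_upto_def)
next
  case True
  have vm: "v \<in> multi_indices" and vN: "weight v \<le> int N"
    using v by (auto simp: multi_indices_upto_def)
  have le: "nat (v \<alpha>) \<le> N" for \<alpha>
    using multi_index_le_weight[OF vm, of \<alpha>] vN by linarith
  have eq: "nat (v \<alpha>) = nat (u \<alpha>) \<longleftrightarrow> v \<alpha> = u \<alpha>" for \<alpha>
    using True vm by (auto simp: multi_indices_def eq_nat_nat_iff)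
  have "(\<Sum>g\<in>PiE UNIV (\<lambda>_. {..N}).
          (\<Prod>\<alpha>\<in>UNIV. coeff (lagrange_basis N (g \<alpha>)) (nat (u \<alpha>))) * monomial (\<lambda>\<alpha>. real (g \<alpha>)) v)
      = (\<Sum>g\<in>PiE UNIV (\<lambda>_. {..N}).
          \<Prod>\<alpha>\<in>UNIV. coeff (lagrange_basis N (g \<alpha>)) (nat (u \<alpha>)) * real (g \<alpha>) ^ nat (v \<alpha>))"
    by (simp add: monomial_def prod.distrib)
  \<comment> \<open>The grid and the weights are products, so the sum splits into one sum per variable.\<close>
  also have "\<dots> = (\<Prod>\<alpha>\<in>UNIV. \<Sum>i\<le>N. coeff (lagrange_basis N i) (nat (u \<alpha>)) * real i ^ nat (v \<alpha>))"
    by (rule prod_sum_PiE[symmetric]) auto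
  also have "\<dots> = (\<Prod>\<alpha>\<in>UNIV. if v \<alpha> = u \<alpha> then 1 else 0)"
    using sum_coeff_lagrange_basis[OF le] by (simp add: eq)
  also have "\<dots> = (if u = v then 1 else 0)"
    by (cases "v = u") (auto simp: fun_eq_iff)
  finally show ?thesis
    using True by (simp add: coefficient_at_def scaleR_sum_left[symmetric])
qed

lemma coefficient_at_linear:
  assumes "linear h"
  shows "coefficient_at N u (\<lambda>t. h (f t)) = h (coefficient_at N u f)"
  by (simp add: coefficient_at_def linear_sum[OF assms] linear_scale[OF assms] linear_0[OF assms])

lemma coefficient_at_sum:
  "coefficient_at N u (\<lambda>t. \<Sum>i\<in>I. f i t) = (\<Sum>i\<in>I. coefficient_at N u (f i))"
  unfolding coefficient_at_def
  by (simp add: scaleR_sum_right sum.swap[of _ I])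

lemma coefficient_at_diff:
  "coefficient_at N u (\<lambda>t. f t - g t) = coefficient_at N u f - coefficient_at N u g"
  unfolding coefficient_at_def by (simp add: scaleR_diff_right sum_subtractf)

text \<open>
  A coefficient can be differentiated in a parameter value by value, since only finitely many values
  of \<open>t\<close> enter.
\<close>

lemma coefficient_at_has_derivative:
  assumes "\<And>t. ((\<lambda>\<tau>. f \<tau> t) has_real_derivative f' t) (at x)"
  shows "((\<lambda>\<tau>. coefficient_at N u (f \<tau>)) has_real_derivative coefficient_at N u f') (at x)"
  unfolding coefficient_at_def
  by (cases "u \<in> multi_indices") (auto intro!: DERIV_sum DERIV_cmult assms)

section \<open>Polynomial functions of several variables\<close>

definition polynomial_fun :: "nat \<Rightarrow> (('q::finite \<Rightarrow> real) \<Rightarrow> 'b::real_normed_vector) \<Rightarrow> bool" where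
  "polynomial_fun N f \<longleftrightarrow>
     (\<exists>s. \<forall>t. f t = (\<Sum>u\<in>multi_indices_upto N. monomial t u *\<^sub>R s u))"

lemma coefficient_at_expansion:
  assumes "n \<le> N"
  shows "coefficient_at N u (\<lambda>t. \<Sum>v\<in>multi_indices_upto n. monomial t v *\<^sub>R s v) =
    (if u \<in> multi_indices_upto n then s u else 0)"
proof -
  have "coefficient_at N u (\<lambda>t. monomial t v *\<^sub>R s v) = (if u = v then s v else 0)"
    if "v \<in> multi_indices_upto n" for v
    using that assms by (intro coefficient_at_monomial) (auto simp: multi_indices_upto_def)
  then show ?thesis by (simp add: coefficient_at_sum)
qed

lemma polynomial_fun_expansion:
  assumes "polynomial_fun n f" "n \<le> N"
  shows "f t = (\<Sum>u\<in>multi_indices_upto n. monomial t u *\<^sub>R coefficient_at N u f)"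
    and "u \<notin> multi_indices_upto n \<Longrightarrow> coefficient_at N u f = 0"
proof -
  obtain s where f: "f = (\<lambda>t. \<Sum>u\<in>multi_indices_upto n. monomial t u *\<^sub>R s u)"
    using assms(1) unfolding polynomial_fun_def by blast
  have c: "coefficient_at N u f = (if u \<in> multi_indices_upto n then s u else 0)" for u
    unfolding f by (rule coefficient_at_expansion[OF assms(2)])
  show "f t = (\<Sum>u\<in>multi_indices_upto n. monomial t u *\<^sub>R coefficient_at N u f)"
    unfolding c by (subst f) simp
  show "u \<notin> multi_indices_upto n \<Longrightarrow> coefficient_at N u f = 0" by (simp add: c)
qed

lemma polynomial_fun_sum:
  assumes "\<And>i. i \<in> I \<Longrightarrow> polynomial_fun N (f i)"
  shows "polynomial_fun N (\<lambda>t. \<Sum>i\<in>I. f i t)"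
proof -
  have "\<forall>i\<in>I. \<exists>s. \<forall>t. f i t = (\<Sum>u\<in>multi_indices_upto N. monomial t u *\<^sub>R s u)"
    using assms unfolding polynomial_fun_def by blast
  then obtain s where
    s: "\<And>i t. i \<in> I \<Longrightarrow> f i t = (\<Sum>u\<in>multi_indices_upto N. monomial t u *\<^sub>R s i u)"
    by metis
  show ?thesis
    unfolding polynomial_fun_def
  proof (intro exI allI)
    fix t
    show "(\<Sum>i\<in>I. f i t) = (\<Sum>u\<in>multi_indices_upto N. monomial t u *\<^sub>R (\<Sum>i\<in>I. s i u))"
      by (simp add: s scaleR_sum_right sum.swap[of _ I] cong: sum.cong)
  qed
qed

lemma polynomial_fun_linear:
  assumes "polynomial_fun N f" "linear h"
  shows "polynomial_fun N (\<lambda>t. h (f t))"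
proof -
  obtain s where f: "\<And>t. f t = (\<Sum>u\<in>multi_indices_upto N. monomial t u *\<^sub>R s u)"
    using assms(1) unfolding polynomial_fun_def by blast
  have "h (f t) = (\<Sum>u\<in>multi_indices_upto N. monomial t u *\<^sub>R h (s u))" for t
    by (simp add: f linear_sum[OF assms(2)] linear_scale[OF assms(2)])
  then show ?thesis unfolding polynomial_fun_def by (intro exI[of _ "\<lambda>u. h (s u)"]) simp
qed

lemma polynomial_fun_monomial:
  assumes "u \<in> multi_indices_upto N"
  shows "polynomial_fun N (\<lambda>t. monomial t u *\<^sub>R x)"
  unfolding polynomial_fun_def
proof (intro exI allI)
  fix t :: "'a \<Rightarrow> real"
  have "(\<Sum>v\<in>multi_indices_upto N. monomial t v *\<^sub>R (if v = u then x else 0))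
      = (\<Sum>v\<in>multi_indices_upto N. if v = u then monomial t v *\<^sub>R x else 0)"
    by (intro sum.cong) auto
  then show "monomial t u *\<^sub>R x =
      (\<Sum>v\<in>multi_indices_upto N. monomial t v *\<^sub>R (if v = u then x else 0))"
    using assms by simp
qed

lemma multi_indices_add: "u \<in> multi_indices \<Longrightarrow> v \<in> multi_indices \<Longrightarrow> (\<lambda>\<alpha>. u \<alpha> + v \<alpha>) \<in> multi_indices"
  by (simp add: multi_indices_def)

lemma weight_add: "weight (\<lambda>\<alpha>. u \<alpha> + v \<alpha>) = weight u + weight v"
  by (simp add: weight_def sum.distrib)

lemma monomial_add:
  "u \<in> multi_indices \<Longrightarrow> v \<in> multi_indices \<Longrightarrow>
    monomial t (\<lambda>\<alpha>. u \<alpha> + v \<alpha>) = monomial t u * monomial t v"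
  by (simp add: monomial_def multi_indices_def nat_add_distrib power_add prod.distrib)

lemma polynomial_fun_mult:
  fixes f :: "('q::finite \<Rightarrow> real) \<Rightarrow> real" and g :: "('q \<Rightarrow> real) \<Rightarrow> 'b::real_normed_vector"
  assumes "polynomial_fun M f" "polynomial_fun N g"
  shows "polynomial_fun (M + N) (\<lambda>t. f t *\<^sub>R g t)"
proof -
  obtain r where r: "\<And>t. f t = (\<Sum>u\<in>multi_indices_upto M. monomial t u *\<^sub>R r u)"
    using assms(1) unfolding polynomial_fun_def by blast
  obtain s where s: "\<And>t. g t = (\<Sum>v\<in>multi_indices_upto N. monomial t v *\<^sub>R s v)"
    using assms(2) unfolding polynomial_fun_def by blast
  have "f t *\<^sub>R g t = (\<Sum>u\<in>multi_indices_upto M. \<Sum>v\<in>multi_indices_upto N.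
      monomial t (\<lambda>\<alpha>. u \<alpha> + v \<alpha>) *\<^sub>R (r u *\<^sub>R s v))" for t
    unfolding r[of t] s[of t] scaleR_sum_left
    unfolding scaleR_sum_right
    by (intro sum.cong refl) (simp add: multi_indices_upto_def monomial_add mult_ac)
  moreover have "polynomial_fun (M + N) (\<lambda>t. \<Sum>u\<in>multi_indices_upto M. \<Sum>v\<in>multi_indices_upto N.
      monomial t (\<lambda>\<alpha>. u \<alpha> + v \<alpha>) *\<^sub>R (r u *\<^sub>R s v))"
    by (intro polynomial_fun_sum polynomial_fun_monomial)
      (auto simp: multi_indices_upto_def multi_indices_add weight_add)
  ultimately show ?thesis by simp
qed

lemma polynomial_fun_const: "polynomial_fun N (\<lambda>t :: 'q::finite \<Rightarrow> real. x)"
proof -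
  have "(\<lambda>\<alpha>::'q. 0) \<in> multi_indices_upto N"
    by (simp add: multi_indices_upto_def multi_indices_def weight_def)
  from polynomial_fun_monomial[OF this, of x] show ?thesis
    by (simp add: monomial_def)
qed

definition unit_index :: "'q::finite \<Rightarrow> 'q \<Rightarrow> int" where
  "unit_index \<alpha> = (\<lambda>\<beta>. if \<beta> = \<alpha> then 1 else 0)"

lemma unit_index:
  "unit_index \<alpha> \<in> multi_indices" "weight (unit_index \<alpha>) = 1" "monomial t (unit_index \<alpha>) = t \<alpha>"
proof -
  have "monomial t (unit_index \<alpha>) = (\<Prod>\<beta>\<in>UNIV. if \<beta> = \<alpha> then t \<beta> else 1)"
    unfolding monomial_def by (intro prod.cong) (auto simp: unit_index_def)
  then show "monomial t (unit_index \<alpha>) = t \<alpha>" by simp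
qed (simp_all add: unit_index_def multi_indices_def weight_def)

lemma polynomial_fun_coordinate: "polynomial_fun 1 (\<lambda>t. t \<alpha> *\<^sub>R x)"
  using polynomial_fun_monomial[of "unit_index \<alpha>" 1 x]
  by (simp add: multi_indices_upto_def unit_index)

lemma polynomial_fun_add:
  assumes "polynomial_fun N f" "polynomial_fun N g"
  shows "polynomial_fun N (\<lambda>t. f t + g t)"
  using polynomial_fun_sum[of "UNIV :: bool set" N "\<lambda>b. if b then f else g"] assms
  by (simp add: UNIV_bool add.commute)

lemma polynomial_fun_prod:
  fixes f :: "'i \<Rightarrow> ('q::finite \<Rightarrow> real) \<Rightarrow> real"
  assumes "finite I" "\<And>i. i \<in> I \<Longrightarrow> polynomial_fun 1 (f i)"
  shows "polynomial_fun (card I) (\<lambda>t. \<Prod>i\<in>I. f i t)"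
  using assms
proof (induction I)
  case empty
  then show ?case by (simp add: polynomial_fun_const)
next
  case (insert i I)
  then show ?case using polynomial_fun_mult[of 1 "f i" "card I" "\<lambda>t. \<Prod>i\<in>I. f i t"] by simp
qed

text \<open>
  This is where the lowered indices come from. The degree bound has to leave room for the additional
  factor.
\<close>

lemma coefficient_at_times_coordinate:
  assumes "polynomial_fun n f" "n < N"
  shows "coefficient_at N u (\<lambda>t. t \<alpha> *\<^sub>R f t) = coefficient_at N (flat \<alpha> u) f"
proof -
  obtain s where f: "f = (\<lambda>t. \<Sum>v\<in>multi_indices_upto n. monomial t v *\<^sub>R s v)"
    using assms(1) unfolding polynomial_fun_def by blast
  have shift: "u = (\<lambda>\<beta>. unit_index \<alpha> \<beta> + v \<beta>) \<longleftrightarrow> flat \<alpha> u = v" for v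
    by (auto simp: flat_def unit_index_def fun_eq_iff)
  have summand: "coefficient_at N u (\<lambda>t. t \<alpha> *\<^sub>R monomial t v *\<^sub>R s v) = (if flat \<alpha> u = v then s v else 0)"
    if v: "v \<in> multi_indices_upto n" for v
  proof -
    have "(\<lambda>\<beta>. unit_index \<alpha> \<beta> + v \<beta>) \<in> multi_indices_upto N"
      using v assms(2) by (simp add: multi_indices_upto_def multi_indices_add unit_index weight_add)
    from coefficient_at_monomial[OF this, of u "s v"] show ?thesis
      using v by (simp add: monomial_add multi_indices_upto_def unit_index shift)
  qed
  have "coefficient_at N u (\<lambda>t. t \<alpha> *\<^sub>R f t)
      = (\<Sum>v\<in>multi_indices_upto n. if flat \<alpha> u = v then s v else 0)"
    unfolding f scaleR_sum_right coefficient_at_sum by (intro sum.cong summand refl)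
  also have "\<dots> = coefficient_at N (flat \<alpha> u) f"
    unfolding f using coefficient_at_expansion[of n N "flat \<alpha> u" s] assms(2) by simp
  finally show ?thesis .
qed

section \<open>Cofactors and Jacobi's formula\<close>

text \<open>
  The sum runs over the bijections from \<open>S - {b}\<close> to \<open>S - {c}\<close>, in the form of permutations of \<open>S\<close> that
  map \<open>b\<close> to \<open>c\<close>. No rows or columns have to be renumbered, and the sign of the cofactor is already the
  sign of the permutation.
\<close>

definition cofactor :: "'a set \<Rightarrow> ('a \<Rightarrow> 'a \<Rightarrow> real) \<Rightarrow> 'a \<Rightarrow> 'a \<Rightarrow> real" where
  "cofactor S m b c =
    (\<Sum>\<pi> | \<pi> permutes S \<and> \<pi> b = c. of_int (sign \<pi>) * (\<Prod>a\<in>S - {b}. m a (\<pi> a)))"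

text \<open>
  Every permutation hits \<open>c\<close> exactly once, so the sum is the Leibniz expansion of the determinant in
  which the entries \<open>m a c\<close> are replaced by \<open>x a\<close>.
\<close>

lemma sum_cofactor:
  assumes S: "finite S" and c: "c \<in> S"
  shows "(\<Sum>b\<in>S. cofactor S m b c * x b) =
    (\<Sum>\<pi> | \<pi> permutes S. of_int (sign \<pi>) * (\<Prod>a\<in>S. if \<pi> a = c then x a else m a (\<pi> a)))"
proof -
  let ?P = "{\<pi>. \<pi> permutes S}"
  let ?t = "\<lambda>\<pi> b. of_int (sign \<pi>) * (\<Prod>a\<in>S - {b}. m a (\<pi> a)) * x b"
  have fin: "finite ?P" by (rule finite_permutations[OF S])
  have "(\<Sum>b\<in>S. cofactor S m b c * x b) = (\<Sum>b\<in>S. \<Sum>\<pi>\<in>?P. if \<pi> b = c then ?t \<pi> b else 0)"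
    using fin by (simp add: cofactor_def sum_distrib_right sum.inter_filter[symmetric])
  also have "\<dots> = (\<Sum>\<pi>\<in>?P. \<Sum>b\<in>S. if \<pi> b = c then ?t \<pi> b else 0)"
    by (rule sum.swap)
  also have "\<dots> = (\<Sum>\<pi>\<in>?P. of_int (sign \<pi>) * (\<Prod>a\<in>S. if \<pi> a = c then x a else m a (\<pi> a)))"
  proof (rule sum.cong[OF refl])
    fix \<pi> assume "\<pi> \<in> ?P"
    then have \<pi>: "\<pi> permutes S" by simp
    define b where "b = inv \<pi> c"
    have b: "b \<in> S" "\<pi> b = c"
      using c \<pi> by (simp_all add: b_def permutes_inv permutes_in_image permutes_inverses)
    have iff: "\<pi> a = c \<longleftrightarrow> a = b" for a
      using b(2) permutes_inj[OF \<pi>] by (auto dest: injD)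
    have "(\<Prod>a\<in>S. if \<pi> a = c then x a else m a (\<pi> a)) = x b * (\<Prod>a\<in>S - {b}. m a (\<pi> a))"
      using S b(1) by (subst prod.remove[of S b]) (auto simp: iff)
    then show "(\<Sum>b\<in>S. if \<pi> b = c then ?t \<pi> b else 0) =
        of_int (sign \<pi>) * (\<Prod>a\<in>S. if \<pi> a = c then x a else m a (\<pi> a))"
      using S b(1) by (simp add: iff)
  qed
  finally show ?thesis .
qed

text \<open>
  For \<open>c \<noteq> d\<close> the matrix behind \<open>sum_cofactor\<close> has equal entries at \<open>c\<close> and \<open>d\<close>. Composing each
  permutation with the transposition of \<open>c\<close> and \<open>d\<close> therefore changes only the sign of its term, so the
  sum equals its own negative.
\<close>

lemma laplace_expansion:
  assumes S: "finite S" and c: "c \<in> S" and d: "d \<in> S"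
  shows "(\<Sum>b\<in>S. cofactor S m b c * m b d) =
    (if c = d then \<Sum>\<pi> | \<pi> permutes S. of_int (sign \<pi>) * (\<Prod>a\<in>S. m a (\<pi> a)) else 0)"
proof (cases "c = d")
  case True
  have "(\<Prod>a\<in>S. if \<pi> a = c then m a d else m a (\<pi> a)) = (\<Prod>a\<in>S. m a (\<pi> a))" for \<pi>
    using True by (intro prod.cong) auto
  then show ?thesis unfolding sum_cofactor[OF S c] using True by simp
next
  case False
  let ?h = "\<lambda>\<pi>. of_int (sign \<pi>) * (\<Prod>a\<in>S. if \<pi> a = c then m a d else m a (\<pi> a))"
  let ?\<tau> = "Transposition.transpose c d"
  have \<tau>: "?\<tau> permutes S" using c d by (rule permutes_swap_id)
  have "(\<Sum>\<pi> | \<pi> permutes S. ?h \<pi>) = (\<Sum>\<pi> | \<pi> permutes S. ?h (?\<tau> \<circ> \<pi>))"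
    by (rule setum_permutations_compose_left[OF \<tau>])
  also have "\<dots> = (\<Sum>\<pi> | \<pi> permutes S. - ?h \<pi>)"
  proof (rule sum.cong[OF refl], clarify)
    fix \<pi> assume \<pi>: "\<pi> permutes S"
    have "permutation ?\<tau>" "permutation \<pi>"
      using \<tau> \<pi> S by (auto simp: permutation_permutes)
    then have "sign (?\<tau> \<circ> \<pi>) = - sign \<pi>"
      using False by (simp add: sign_compose sign_swap_id)
    moreover have "(\<Prod>a\<in>S. if (?\<tau> \<circ> \<pi>) a = c then m a d else m a ((?\<tau> \<circ> \<pi>) a)) =
        (\<Prod>a\<in>S. if \<pi> a = c then m a d else m a (\<pi> a))"
      by (intro prod.cong) (auto simp: Transposition.transpose_def)
    ultimately show "?h (?\<tau> \<circ> \<pi>) = - ?h \<pi>" by simp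
  qed
  finally show ?thesis
    unfolding sum_cofactor[OF S c] using False by (simp add: sum_negf)
qed

text \<open>
  The rank-one map \<open>x \<mapsto> (c \<bullet> x) b\<close> has its only entry in row \<open>b\<close> and column \<open>c\<close>, whereas the cofactor
  belongs to row \<open>c\<close> and column \<open>b\<close> of \<open>f\<close>: this is the transposition in the adjugate.
\<close>

definition adjugate :: "('v::euclidean_space \<Rightarrow>\<^sub>L 'v) \<Rightarrow> 'v \<Rightarrow>\<^sub>L 'v" where
  "adjugate f = (\<Sum>b\<in>Basis. \<Sum>c\<in>Basis.
     cofactor Basis (\<lambda>a c. f a \<bullet> c) b c *\<^sub>R (blinfun_scaleR_left b o\<^sub>L blinfun_inner_right c))"

lemma adjugate_apply_Basis:
  assumes "c \<in> Basis"
  shows "adjugate f c = (\<Sum>b\<in>Basis. cofactor Basis (\<lambda>a c. f a \<bullet> c) b c *\<^sub>R b)"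
proof -
  have "adjugate f c = (\<Sum>b\<in>Basis. \<Sum>d\<in>Basis.
      if d = c then cofactor Basis (\<lambda>a c. f a \<bullet> c) b d *\<^sub>R b else 0)"
    unfolding adjugate_def blinfun.sum_left
    by (intro sum.cong refl) (use assms in \<open>auto simp: blinfun.scaleR_left inner_Basis\<close>)
  then show ?thesis using assms by simp
qed

lemma endo_trace_compose_adjugate:
  "endo_trace (B o\<^sub>L adjugate f) =
    (\<Sum>b\<in>Basis. \<Sum>c\<in>Basis. cofactor Basis (\<lambda>a c. f a \<bullet> c) b c * (B b \<bullet> c))"
  unfolding endo_trace_def
  by (subst sum.swap, intro sum.cong refl)
    (simp add: adjugate_apply_Basis blinfun.sum_right blinfun.scaleR_right inner_sum_left)

lemma compose_adjugate: "f o\<^sub>L adjugate f = endo_det f *\<^sub>R id_blinfun"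
proof (rule blinfun_eqI, rule euclidean_eqI)
  fix x d :: 'a assume d: "d \<in> Basis"
  have basis: "f (adjugate f c) \<bullet> d = endo_det f * (c \<bullet> d)" if c: "c \<in> Basis" for c
    using laplace_expansion[OF finite_Basis c d, of "\<lambda>a c. f a \<bullet> c"] c d
    by (simp add: adjugate_apply_Basis blinfun.sum_right blinfun.scaleR_right inner_sum_left
        endo_det_def inner_Basis)
  have "f (adjugate f x) \<bullet> d = (\<Sum>c\<in>Basis. (x \<bullet> c) * (f (adjugate f c) \<bullet> d))"
    by (subst euclidean_representation[of x, symmetric])
      (simp only: blinfun.sum_right blinfun.scaleR_right inner_sum_left inner_scaleR_left)
  also have "\<dots> = (\<Sum>c\<in>Basis. endo_det f * ((x \<bullet> c) * (c \<bullet> d)))"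
    by (intro sum.cong refl) (simp add: basis)
  also have "\<dots> = endo_det f * (x \<bullet> d)"
    by (simp add: sum_distrib_left[symmetric] euclidean_inner[of x d] inner_commute[of d])
  finally show "(f o\<^sub>L adjugate f) x \<bullet> d = (endo_det f *\<^sub>R id_blinfun) x \<bullet> d"
    by (simp add: blinfun.scaleR_left)
qed

lemma linear_endo_trace: "linear endo_trace"
  by (rule linearI)
    (simp_all add: endo_trace_def blinfun.add_left blinfun.scaleR_left inner_add_left
      sum.distrib sum_distrib_left)

lemma endo_trace_id: "endo_trace (id_blinfun :: 'v::euclidean_space \<Rightarrow>\<^sub>L 'v) = real DIM('v)"
  by (simp add: endo_trace_def)

interpretation blinfun_compose: bounded_bilinear "(o\<^sub>L)"
  by (rule bounded_bilinear_blinfun_compose)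

lemma blinfun_compose_assoc: "(f o\<^sub>L g) o\<^sub>L h = f o\<^sub>L (g o\<^sub>L h)"
  by (rule blinfun_eqI) simp

lemma blinfun_compose_id [simp]: "id_blinfun o\<^sub>L f = f" "f o\<^sub>L id_blinfun = f"
  by (rule blinfun_eqI; simp)+

lemma linear_compose_left: "linear (\<lambda>X. B o\<^sub>L X)"
  by (rule bounded_linear.linear[OF blinfun_compose.bounded_linear_right])

text \<open>
  The product rule in the Leibniz expansion differentiates one factor at a time; grouping the
  permutations by the image \<open>c\<close> of the chosen basis vector \<open>b\<close> collects the remaining factors into
  cofactors.
\<close>

lemma jacobi_formula:
  fixes f :: "real \<Rightarrow> 'v::euclidean_space \<Rightarrow>\<^sub>L 'v"
  assumes "(f has_vector_derivative f') (at x)"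
  shows "((\<lambda>\<tau>. endo_det (f \<tau>)) has_real_derivative endo_trace (f' o\<^sub>L adjugate (f x))) (at x)"
proof -
  let ?P = "{\<pi>. \<pi> permutes (Basis :: 'v set)}"
  let ?t = "\<lambda>\<pi> b. of_int (sign \<pi>) * (\<Prod>a\<in>Basis - {b}. f x a \<bullet> \<pi> a)"
  have entry: "((\<lambda>\<tau>. f \<tau> b \<bullet> c) has_real_derivative f' b \<bullet> c) (at x)" for b c
  proof -
    have "bounded_linear (\<lambda>g :: 'v \<Rightarrow>\<^sub>L 'v. g b \<bullet> c)"
      by (intro bounded_linear_intros)
    from bounded_linear.has_vector_derivative[OF this assms]
    show ?thesis by (simp add: has_real_derivative_iff_has_vector_derivative)
  qed
  have "((\<lambda>\<tau>. endo_det (f \<tau>)) has_real_derivative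
      (\<Sum>\<pi>\<in>?P. of_int (sign \<pi>) * (\<Sum>b\<in>Basis. (f' b \<bullet> \<pi> b) * (\<Prod>a\<in>Basis - {b}. f x a \<bullet> \<pi> a)))) (at x)"
    unfolding endo_det_def
    by (intro DERIV_sum DERIV_cmult has_field_derivative_prod entry)
  moreover have "(\<Sum>\<pi>\<in>?P. of_int (sign \<pi>) * (\<Sum>b\<in>Basis. (f' b \<bullet> \<pi> b) * (\<Prod>a\<in>Basis - {b}. f x a \<bullet> \<pi> a)))
      = endo_trace (f' o\<^sub>L adjugate (f x))"
  proof -
    have fin: "finite ?P" by (rule finite_permutations) simp
    have "(\<Sum>\<pi>\<in>?P. of_int (sign \<pi>) * (\<Sum>b\<in>Basis. (f' b \<bullet> \<pi> b) * (\<Prod>a\<in>Basis - {b}. f x a \<bullet> \<pi> a)))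
        = (\<Sum>b\<in>Basis. \<Sum>\<pi>\<in>?P. ?t \<pi> b * (f' b \<bullet> \<pi> b))"
      by (subst sum.swap) (simp add: sum_distrib_left mult_ac)
    also have "\<dots> = (\<Sum>b\<in>Basis. \<Sum>c\<in>Basis. \<Sum>\<pi>\<in>{\<pi>\<in>?P. \<pi> b = c}. ?t \<pi> b * (f' b \<bullet> \<pi> b))"
      by (intro sum.cong refl sum.group[symmetric] fin) (auto simp: permutes_in_image)
    also have "\<dots> = endo_trace (f' o\<^sub>L adjugate (f x))"
      unfolding endo_trace_compose_adjugate cofactor_def sum_distrib_right
      by (intro sum.cong refl) auto
    finally show ?thesis .
  qed
  ultimately show ?thesis by simp
qed

section \<open>The pencil and its coefficients\<close>

definition pencil :: "('v::euclidean_space \<Rightarrow>\<^sub>L 'v) ^ 'q::finite \<Rightarrow> ('q \<Rightarrow> real) \<Rightarrow> 'v \<Rightarrow>\<^sub>L 'v" where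
  "pencil A t = id_blinfun + (\<Sum>\<alpha>\<in>UNIV. t \<alpha> *\<^sub>R A $ \<alpha>)"

lemma pencil_diff_id: "pencil A t - id_blinfun = (\<Sum>\<alpha>\<in>UNIV. t \<alpha> *\<^sub>R A $ \<alpha>)"
  by (simp add: pencil_def)

lemma polynomial_fun_pencil_entry:
  fixes b c :: "'v::euclidean_space"
  shows "polynomial_fun 1 (\<lambda>t. pencil A t b \<bullet> c)"
proof -
  have "polynomial_fun 1 (pencil A)"
    unfolding pencil_def [abs_def]
    by (intro polynomial_fun_add polynomial_fun_const polynomial_fun_sum polynomial_fun_coordinate)
  moreover have "linear (\<lambda>g :: 'v \<Rightarrow>\<^sub>L 'v. g b \<bullet> c)"
    by (rule linearI) (simp_all add: blinfun.add_left blinfun.scaleR_left inner_add_left)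
  ultimately show ?thesis by (rule polynomial_fun_linear)
qed

text \<open>
  Each term of the Leibniz expansion is a product of \<open>p\<close> affine functions; in a cofactor one factor is
  missing.
\<close>

lemma polynomial_fun_det_pencil:
  fixes A :: "('v::euclidean_space \<Rightarrow>\<^sub>L 'v) ^ 'q::finite"
  shows "polynomial_fun DIM('v) (\<lambda>t. endo_det (pencil A t))"
  unfolding endo_det_def
  by (intro polynomial_fun_sum polynomial_fun_linear[OF _ linear_times]
      polynomial_fun_prod polynomial_fun_pencil_entry) simp

lemma polynomial_fun_adjugate_pencil:
  fixes A :: "('v::euclidean_space \<Rightarrow>\<^sub>L 'v) ^ 'q::finite"
  shows "polynomial_fun (DIM('v) - 1) (\<lambda>t. adjugate (pencil A t))"
proof -
  have prod: "polynomial_fun (DIM('v) - 1) (\<lambda>t. \<Prod>a\<in>Basis - {b}. pencil A t a \<bullet> \<pi> a)"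
    if "b \<in> Basis" for b :: 'v and \<pi>
    using polynomial_fun_prod[of "Basis - {b}" "\<lambda>a t. pencil A t a \<bullet> \<pi> a"]
      polynomial_fun_pencil_entry[of A] that
    by (simp add: card_Diff_singleton)
  have "linear (\<lambda>r. r *\<^sub>R X)" for X :: "'v \<Rightarrow>\<^sub>L 'v"
    by (intro bounded_linear.linear bounded_linear_intros)
  note lin = polynomial_fun_linear[OF _ this]
  show ?thesis
    unfolding adjugate_def cofactor_def
    by (intro polynomial_fun_sum lin polynomial_fun_linear[OF _ linear_times] prod)
qed

text \<open>
  Both requirements on the family of coefficients hold for the coefficients read off from the
  determinant, and reading them off from any other expansion shows that there is no second family.
\<close>

lemma sigma_eq_coefficient_at:
  fixes A :: "('v::euclidean_space \<Rightarrow>\<^sub>L 'v) ^ 'q::finite"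
  assumes "DIM('v) \<le> N"
  shows "sigma A u = coefficient_at N u (\<lambda>t. endo_det (pencil A t))"
proof -
  let ?D = "\<lambda>t. endo_det (pencil A t)"
  have "sigma A = (THE s. (\<forall>u. u \<notin> multi_indices_upto DIM('v) \<longrightarrow> s u = 0) \<and>
      (\<forall>t. ?D t = (\<Sum>u\<in>multi_indices_upto DIM('v). monomial t u *\<^sub>R s u)))"
    unfolding sigma_def multi_indices_upto_def pencil_def monomial_def
    by (simp add: mult.commute not_le de_Morgan_conj)
  also have "\<dots> = (\<lambda>u. coefficient_at N u ?D)"
  proof (rule the_equality)
    show "(\<forall>u. u \<notin> multi_indices_upto DIM('v) \<longrightarrow> coefficient_at N u ?D = 0) \<and>
      (\<forall>t. ?D t = (\<Sum>u\<in>multi_indices_upto DIM('v). monomial t u *\<^sub>R coefficient_at N u ?D))"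
      using polynomial_fun_expansion[OF polynomial_fun_det_pencil[of A] assms] by blast
  next
    fix s :: "('q \<Rightarrow> int) \<Rightarrow> real"
    assume s: "(\<forall>u. u \<notin> multi_indices_upto DIM('v) \<longrightarrow> s u = 0) \<and>
      (\<forall>t. ?D t = (\<Sum>u\<in>multi_indices_upto DIM('v). monomial t u *\<^sub>R s u))"
    then have D: "?D = (\<lambda>t. \<Sum>u\<in>multi_indices_upto DIM('v). monomial t u *\<^sub>R s u)" by blast
    show "s = (\<lambda>u. coefficient_at N u ?D)"
      unfolding D coefficient_at_expansion[OF assms] using s by (auto simp: fun_eq_iff)
  qed
  finally show ?thesis by simp
qed

text \<open>
  The coefficients of \<open>adj M(t)\<close>. Its degree is at most \<open>p - 1\<close>, so the bound \<open>p\<close> covers its product with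
  a coordinate as well as the determinant.
\<close>

definition newton_family :: "('v::euclidean_space \<Rightarrow>\<^sub>L 'v) ^ 'q::finite \<Rightarrow> ('q \<Rightarrow> int) \<Rightarrow> 'v \<Rightarrow>\<^sub>L 'v" where
  "newton_family A u = coefficient_at DIM('v) u (\<lambda>t. adjugate (pencil A t))"

text \<open>
  With \<open>B = A'\<close> the left side is the derivative of \<open>\<sigma>\<^sub>u\<close> along a curve; with \<open>B = A\<close> it is the
  coefficient of \<open>t\<^sup>u\<close> in \<open>tr ((M - 1) adj M)\<close>.
\<close>

lemma coefficient_at_trace_compose:
  fixes A :: "('v::euclidean_space \<Rightarrow>\<^sub>L 'v) ^ 'q::finite"
  shows "coefficient_at DIM('v) u
      (\<lambda>t. endo_trace ((\<Sum>\<alpha>\<in>UNIV. t \<alpha> *\<^sub>R B \<alpha>) o\<^sub>L adjugate (pencil A t)))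
    = (\<Sum>\<alpha>\<in>UNIV. endo_trace (B \<alpha> o\<^sub>L newton_family A (flat \<alpha> u)))"
proof -
  have lin: "linear (\<lambda>X. endo_trace (B \<alpha> o\<^sub>L X))" for \<alpha>
    using linear_compose[OF linear_compose_left linear_endo_trace] by (simp add: o_def)
  have "endo_trace ((\<Sum>\<alpha>\<in>UNIV. t \<alpha> *\<^sub>R B \<alpha>) o\<^sub>L adjugate (pencil A t))
      = (\<Sum>\<alpha>\<in>UNIV. endo_trace (B \<alpha> o\<^sub>L (t \<alpha> *\<^sub>R adjugate (pencil A t))))" for t
    by (simp add: blinfun_compose.sum_left linear_sum[OF linear_endo_trace]
        blinfun_compose.scaleR_left blinfun_compose.scaleR_right)
  then have "coefficient_at DIM('v) u
      (\<lambda>t. endo_trace ((\<Sum>\<alpha>\<in>UNIV. t \<alpha> *\<^sub>R B \<alpha>) o\<^sub>L adjugate (pencil A t)))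
    = (\<Sum>\<alpha>\<in>UNIV. endo_trace (B \<alpha> o\<^sub>L
        coefficient_at DIM('v) u (\<lambda>t. t \<alpha> *\<^sub>R adjugate (pencil A t))))"
    by (simp add: coefficient_at_sum coefficient_at_linear[OF lin])
  then show ?thesis
    by (simp add: newton_family_def
        coefficient_at_times_coordinate[OF polynomial_fun_adjugate_pencil])
qed

section \<open>The generalized Newton transformation\<close>

lemma newton_family_is_newton_transformation:
  fixes A :: "('v::euclidean_space \<Rightarrow>\<^sub>L 'v) ^ 'q::finite"
  shows "is_newton_transformation A (newton_family A)"
  unfolding is_newton_transformation_def
proof (intro conjI allI ballI impI)
  fix w :: "'q \<Rightarrow> int" assume "w \<notin> multi_indices"
  then show "newton_family A w = 0" by (simp add: newton_family_def coefficient_at_def)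
next
  fix u :: "'q \<Rightarrow> int" and \<epsilon> :: real and c :: "real \<Rightarrow> ('v \<Rightarrow>\<^sub>L 'v) ^ 'q"
  assume "\<epsilon> > 0" and c: "smooth_curve_on {-\<epsilon><..<\<epsilon>} c \<and> c 0 = A"
  have "\<forall>n. ((\<lambda>f s. vector_derivative f (at s)) ^^ n) c differentiable (at 0)"
    using c \<open>\<epsilon> > 0\<close> unfolding smooth_curve_on_def by simp
  from spec[OF this, of 0] have "c differentiable (at 0)" by simp
  then have c': "(c has_vector_derivative vector_derivative c (at 0)) (at 0)"
    by (simp add: vector_derivative_works)
  have "((\<lambda>\<tau>. pencil (c \<tau>) t) has_vector_derivative
      (\<Sum>\<alpha>\<in>UNIV. t \<alpha> *\<^sub>R vector_derivative c (at 0) $ \<alpha>)) (at 0)" for t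
  proof -
    have "bounded_linear (\<lambda>X :: ('v \<Rightarrow>\<^sub>L 'v) ^ 'q. \<Sum>\<alpha>\<in>UNIV. t \<alpha> *\<^sub>R X $ \<alpha>)"
      by (intro bounded_linear_sum bounded_linear_compose[OF bounded_linear_scaleR_right]
          bounded_linear_vec_nth)
    from has_vector_derivative_add[OF has_vector_derivative_const[of id_blinfun]
        bounded_linear.has_vector_derivative[OF this c']]
    show ?thesis unfolding pencil_def by simp
  qed
  from jacobi_formula[OF this]
  have "((\<lambda>\<tau>. coefficient_at DIM('v) u (\<lambda>t. endo_det (pencil (c \<tau>) t))) has_real_derivative
      coefficient_at DIM('v) u (\<lambda>t. endo_trace
        ((\<Sum>\<alpha>\<in>UNIV. t \<alpha> *\<^sub>R vector_derivative c (at 0) $ \<alpha>) o\<^sub>L adjugate (pencil A t)))) (at 0)"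
    using c by (intro coefficient_at_has_derivative) simp
  then show "((\<lambda>\<tau>. sigma (c \<tau>) u) has_real_derivative
      (\<Sum>\<alpha>\<in>UNIV. endo_trace ((vector_derivative c (at 0) $ \<alpha>) o\<^sub>L newton_family A (flat \<alpha> u)))) (at 0)"
    by (simp add: coefficient_at_trace_compose sigma_eq_coefficient_at[of "DIM('v)"])
qed

text \<open>
  The iterated derivatives of an affine curve are again affine; this form is stable under induction.
\<close>

lemma smooth_curve_affine:
  fixes a b :: "'b::real_normed_vector"
  assumes "open S"
  shows "smooth_curve_on S (\<lambda>\<tau>. a + \<tau> *\<^sub>R b)"
proof -
  have deriv: "((\<lambda>\<tau>. a + \<tau> *\<^sub>R b) has_vector_derivative b) (at s)" for a b :: 'b and s
    by (auto intro!: derivative_eq_intros)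
  have "\<exists>a' b'. ((\<lambda>f s. vector_derivative f (at s)) ^^ n) (\<lambda>\<tau>. a + \<tau> *\<^sub>R b) = (\<lambda>\<tau>. a' + \<tau> *\<^sub>R b')" for n
  proof (induction n)
    case 0
    then show ?case by auto
  next
    case (Suc n)
    then obtain a' b' where
      "((\<lambda>f s. vector_derivative f (at s)) ^^ n) (\<lambda>\<tau>. a + \<tau> *\<^sub>R b) = (\<lambda>\<tau>. a' + \<tau> *\<^sub>R b')" by blast
    then have "((\<lambda>f s. vector_derivative f (at s)) ^^ Suc n) (\<lambda>\<tau>. a + \<tau> *\<^sub>R b) = (\<lambda>\<tau>. b' + \<tau> *\<^sub>R 0)"
      by (simp add: vector_derivative_at[OF deriv])
    then show ?case by blast
  qed
  then show ?thesis
    unfolding smooth_curve_on_def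
    using assms deriv by (metis differentiableI_vector)
qed

text \<open>
  Testing against the rank-one maps \<open>y \<mapsto> (d \<bullet> y) x\<close> recovers the numbers \<open>X x \<bullet> d\<close>.
\<close>

lemma endo_trace_eqI:
  fixes X Y :: "'v::euclidean_space \<Rightarrow>\<^sub>L 'v"
  assumes "\<And>B. endo_trace (B o\<^sub>L X) = endo_trace (B o\<^sub>L Y)"
  shows "X = Y"
proof (rule blinfun_eqI, rule euclidean_eqI)
  fix x d :: 'v assume d: "d \<in> Basis"
  have tr: "endo_trace ((blinfun_scaleR_left x o\<^sub>L blinfun_inner_right d) o\<^sub>L Z) = Z x \<bullet> d" for Z :: "'v \<Rightarrow>\<^sub>L 'v"
  proof -
    have "Z x \<bullet> d = (\<Sum>b\<in>Basis. (x \<bullet> b) * (Z b \<bullet> d))"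
      by (subst euclidean_representation[of x, symmetric])
        (simp only: blinfun.sum_right blinfun.scaleR_right inner_sum_left inner_scaleR_left)
    then show ?thesis
      by (simp add: endo_trace_def inner_commute mult.commute)
  qed
  show "X x \<bullet> d = Y x \<bullet> d"
    using assms[of "blinfun_scaleR_left x o\<^sub>L blinfun_inner_right d"] by (simp add: tr)
qed

text \<open>
  For a multi-index \<open>w\<close>, raise one entry \<open>\<alpha>\<close> to get \<open>u\<close> and move only \<open>A\<^sub>\<alpha>\<close>, with velocity \<open>B\<close>. The sum
  over the lowered indices of \<open>u\<close> then reduces to \<open>tr (B T\<^sub>w)\<close>, which is thereby determined by \<open>\<sigma>\<^sub>u\<close> for
  every \<open>B\<close>.
\<close>

lemma is_newton_transformation_unique:
  fixes A :: "('v::euclidean_space \<Rightarrow>\<^sub>L 'v) ^ 'q::finite"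
  assumes T: "is_newton_transformation A T" and T': "is_newton_transformation A T'"
  shows "T = T'"
proof
  fix w :: "'q \<Rightarrow> int"
  show "T w = T' w"
  proof (cases "w \<in> multi_indices")
    case False
    then show ?thesis using T T' by (simp add: is_newton_transformation_def)
  next
    case True
    obtain \<alpha> :: 'q where True by simp
    define u where "u = w(\<alpha> := w \<alpha> + 1)"
    have u: "u \<in> multi_indices" "flat \<alpha> u = w"
      using True by (auto simp: u_def multi_indices_def flat_def)
    show ?thesis
    proof (rule endo_trace_eqI)
      fix B :: "'v \<Rightarrow>\<^sub>L 'v"
      define c where "c = (\<lambda>\<tau>. A + \<tau> *\<^sub>R axis \<alpha> B)"
      have smooth: "smooth_curve_on {- 1<..<1} c" "c 0 = A"
        unfolding c_def by (auto intro: smooth_curve_affine)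
      have c': "vector_derivative c (at 0) = axis \<alpha> B"
        unfolding c_def by (rule vector_derivative_at) (auto intro!: derivative_eq_intros)
      have deriv: "((\<lambda>\<tau>. sigma (c \<tau>) u) has_real_derivative endo_trace (B o\<^sub>L R w)) (at 0)"
        if "is_newton_transformation A R" for R
      proof -
        have "((\<lambda>\<tau>. sigma (c \<tau>) u) has_real_derivative
            (\<Sum>\<beta>\<in>UNIV. endo_trace ((vector_derivative c (at 0) $ \<beta>) o\<^sub>L R (flat \<beta> u)))) (at 0)"
          using that u smooth zero_less_one unfolding is_newton_transformation_def by blast
        moreover have "endo_trace ((axis \<alpha> B $ \<beta>) o\<^sub>L R (flat \<beta> u)) =
            (if \<beta> = \<alpha> then endo_trace (B o\<^sub>L R w) else 0)" for \<beta>
          by (simp add: axis_def u linear_0[OF linear_endo_trace])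
        ultimately show ?thesis by (simp add: c')
      qed
      show "endo_trace (B o\<^sub>L T w) = endo_trace (B o\<^sub>L T' w)"
        using DERIV_unique[OF deriv[OF T] deriv[OF T']] .
    qed
  qed
qed

lemma newton_transformation_eq_newton_family: "newton_transformation A = newton_family A"
  unfolding newton_transformation_def
  using newton_family_is_newton_transformation[of A]
  by (auto intro: the_equality is_newton_transformation_unique)

section \<open>The trace identities\<close>

text \<open>
  Both sides are the derivative of \<open>x \<mapsto> D(x t)\<close> at \<open>x = 1\<close>: the left side by Jacobi's formula, because
  \<open>M(x t) = 1 + x (M(t) - 1)\<close>, and the right side because \<open>t\<^sup>u\<close> is homogeneous of degree \<open>|u|\<close>.
\<close>

lemma euler_identity:
  fixes A :: "('v::euclidean_space \<Rightarrow>\<^sub>L 'v) ^ 'q::finite"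
  shows "endo_trace ((pencil A t - id_blinfun) o\<^sub>L adjugate (pencil A t)) =
    (\<Sum>u\<in>multi_indices_upto DIM('v). monomial t u *\<^sub>R (of_int (weight u) * sigma A u))"
proof -
  let ?I = "multi_indices_upto DIM('v) :: ('q \<Rightarrow> int) set"
  have "((\<lambda>x. pencil A (\<lambda>\<alpha>. x * t \<alpha>)) has_vector_derivative (pencil A t - id_blinfun)) (at 1)"
  proof -
    have "pencil A (\<lambda>\<alpha>. x * t \<alpha>) = id_blinfun + x *\<^sub>R (pencil A t - id_blinfun)" for x
      by (simp add: pencil_def scaleR_sum_right)
    then show ?thesis by (auto intro!: derivative_eq_intros)
  qed
  from jacobi_formula[OF this]
  have d1: "((\<lambda>x. endo_det (pencil A (\<lambda>\<alpha>. x * t \<alpha>))) has_real_derivative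
      endo_trace ((pencil A t - id_blinfun) o\<^sub>L adjugate (pencil A t))) (at 1)"
    by simp
  have homogeneous: "monomial (\<lambda>\<alpha>. x * t \<alpha>) u = x ^ nat (weight u) * monomial t u"
    if "u \<in> ?I" for x u
  proof -
    have "int (\<Sum>\<alpha>\<in>UNIV. nat (u \<alpha>)) = weight u"
      using that by (simp add: multi_indices_upto_def multi_indices_def weight_def)
    then have "(\<Sum>\<alpha>\<in>UNIV. nat (u \<alpha>)) = nat (weight u)" by linarith
    then show ?thesis
      by (simp add: monomial_def power_mult_distrib prod.distrib power_sum[symmetric])
  qed
  have "endo_det (pencil A (\<lambda>\<alpha>. x * t \<alpha>)) =
      (\<Sum>u\<in>?I. x ^ nat (weight u) * (monomial t u * sigma A u))" for x
    using polynomial_fun_expansion(1)[OF polynomial_fun_det_pencil[of A] order_refl, of "\<lambda>\<alpha>. x * t \<alpha>"]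
    by (simp add: homogeneous sigma_eq_coefficient_at[OF order_refl] mult.assoc cong: sum.cong)
  moreover have "((\<lambda>x. \<Sum>u\<in>?I. x ^ nat (weight u) * (monomial t u * sigma A u)) has_real_derivative
      (\<Sum>u\<in>?I. real (nat (weight u)) * (monomial t u * sigma A u))) (at 1)"
    by (auto intro!: derivative_eq_intros sum.cong)
  ultimately have d2: "((\<lambda>x. endo_det (pencil A (\<lambda>\<alpha>. x * t \<alpha>))) has_real_derivative
      (\<Sum>u\<in>?I. real (nat (weight u)) * (monomial t u * sigma A u))) (at 1)"
    by simp
  have "real (nat (weight u)) = of_int (weight u)" if "u \<in> ?I" for u
    using that weight_nonneg[of u] by (simp add: multi_indices_upto_def)
  then show ?thesis
    unfolding DERIV_unique[OF d1 d2] by (intro sum.cong) simp_all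
qed

lemma coefficient_at_euler:
  fixes A :: "('v::euclidean_space \<Rightarrow>\<^sub>L 'v) ^ 'q::finite"
  shows "coefficient_at DIM('v) u
      (\<lambda>t. endo_trace ((pencil A t - id_blinfun) o\<^sub>L adjugate (pencil A t)))
    = of_int (weight u) * sigma A u"
proof -
  have "sigma A u = 0" if "u \<notin> multi_indices_upto DIM('v)"
    using polynomial_fun_expansion(2)[OF polynomial_fun_det_pencil[of A] order_refl that]
    by (simp add: sigma_eq_coefficient_at[OF order_refl])
  then show ?thesis
    unfolding euler_identity by (subst coefficient_at_expansion) auto
qed

text \<open>
  The coefficient of \<open>t\<^sup>u\<close> in \<open>(M - 1) adj M = D 1 - adj M\<close>.
\<close>

lemma newton_family_recursion:
  fixes A :: "('v::euclidean_space \<Rightarrow>\<^sub>L 'v) ^ 'q::finite"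
  shows "(\<Sum>\<beta>\<in>UNIV. A $ \<beta> o\<^sub>L newton_family A (flat \<beta> u)) =
    sigma A u *\<^sub>R id_blinfun - newton_family A u"
proof -
  let ?N = "DIM('v)"
  let ?D = "\<lambda>t. endo_det (pencil A t)" and ?Adj = "\<lambda>t. adjugate (pencil A t)"
  have "(\<Sum>\<beta>\<in>UNIV. A $ \<beta> o\<^sub>L newton_family A (flat \<beta> u)) =
      (\<Sum>\<beta>\<in>UNIV. coefficient_at ?N u (\<lambda>t. A $ \<beta> o\<^sub>L (t \<beta> *\<^sub>R ?Adj t)))"
    by (simp add: coefficient_at_linear[OF linear_compose_left] newton_family_def
        coefficient_at_times_coordinate[OF polynomial_fun_adjugate_pencil])
  also have "\<dots> = coefficient_at ?N u (\<lambda>t. (\<Sum>\<beta>\<in>UNIV. t \<beta> *\<^sub>R A $ \<beta>) o\<^sub>L ?Adj t)"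
    by (simp add: coefficient_at_sum[symmetric] blinfun_compose.sum_left
        blinfun_compose.scaleR_left blinfun_compose.scaleR_right)
  also have "\<dots> = coefficient_at ?N u (\<lambda>t. ?D t *\<^sub>R id_blinfun - ?Adj t)"
    by (simp add: pencil_diff_id[symmetric] blinfun_compose.diff_left compose_adjugate)
  also have "\<dots> = sigma A u *\<^sub>R id_blinfun - newton_family A u"
  proof -
    have "linear (\<lambda>r. r *\<^sub>R (id_blinfun :: 'v \<Rightarrow>\<^sub>L 'v))"
      by (intro bounded_linear.linear bounded_linear_intros)
    from coefficient_at_linear[OF this, of ?N u ?D] show ?thesis
      by (simp add: coefficient_at_diff newton_family_def sigma_eq_coefficient_at[of ?N])
  qed
  finally show ?thesis .
qed

theorem proposition3p3:
  fixes A :: "('v::euclidean_space \<Rightarrow>\<^sub>L 'v) ^ 'q::finite"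
    and T :: "('q \<Rightarrow> int) \<Rightarrow> ('v \<Rightarrow>\<^sub>L 'v)"
  assumes T: "T = newton_transformation A"
  shows "\<forall>u\<in>multi_indices.
      of_int (weight u) * sigma A u =
        (\<Sum>\<alpha>\<in>UNIV. endo_trace (A $ \<alpha> o\<^sub>L T (flat \<alpha> u)))
    \<and> endo_trace (T u) = (real DIM('v) - of_int (weight u)) * sigma A u
    \<and> (\<Sum>\<alpha>\<in>UNIV. \<Sum>\<beta>\<in>UNIV.
          endo_trace (A $ \<alpha> o\<^sub>L A $ \<beta> o\<^sub>L T (flat \<beta> (flat \<alpha> u)))) =
        - of_int (weight u) * sigma A u
        + (\<Sum>\<alpha>\<in>UNIV. endo_trace (A $ \<alpha>) * sigma A (flat \<alpha> u))"
proof (intro ballI conjI)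
  fix u :: "'q \<Rightarrow> int" assume "u \<in> multi_indices"
  note TA = T[unfolded newton_transformation_eq_newton_family]
  note coeff = newton_family_recursion[of A, folded TA]
  have trace_diff: "endo_trace (X - Y) = endo_trace X - endo_trace Y" for X Y :: "'v \<Rightarrow>\<^sub>L 'v"
    by (rule linear_diff[OF linear_endo_trace])
  show GN1: "of_int (weight u) * sigma A u = (\<Sum>\<alpha>\<in>UNIV. endo_trace (A $ \<alpha> o\<^sub>L T (flat \<alpha> u)))"
    using coefficient_at_euler[of u A] coefficient_at_trace_compose[of u "\<lambda>\<alpha>. A $ \<alpha>" A]
    by (simp add: pencil_diff_id TA)
  show "endo_trace (T u) = (real DIM('v) - of_int (weight u)) * sigma A u"
    using arg_cong[OF coeff[of u], of endo_trace]
    by (simp add: linear_sum[OF linear_endo_trace] GN1[symmetric] trace_diff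
        linear_scale[OF linear_endo_trace] endo_trace_id algebra_simps)
  have "(\<Sum>\<beta>\<in>UNIV. endo_trace (A $ \<alpha> o\<^sub>L A $ \<beta> o\<^sub>L T (flat \<beta> (flat \<alpha> u)))) =
      endo_trace (A $ \<alpha>) * sigma A (flat \<alpha> u) - endo_trace (A $ \<alpha> o\<^sub>L T (flat \<alpha> u))" for \<alpha>
  proof -
    have "(\<Sum>\<beta>\<in>UNIV. endo_trace (A $ \<alpha> o\<^sub>L A $ \<beta> o\<^sub>L T (flat \<beta> (flat \<alpha> u)))) =
        endo_trace (A $ \<alpha> o\<^sub>L (\<Sum>\<beta>\<in>UNIV. A $ \<beta> o\<^sub>L T (flat \<beta> (flat \<alpha> u))))"
      by (simp add: blinfun_compose.sum_right linear_sum[OF linear_endo_trace] blinfun_compose_assoc)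
    then show ?thesis
      by (simp add: coeff blinfun_compose.diff_right trace_diff blinfun_compose.scaleR_right
          linear_scale[OF linear_endo_trace])
  qed
  then show "(\<Sum>\<alpha>\<in>UNIV. \<Sum>\<beta>\<in>UNIV.
          endo_trace (A $ \<alpha> o\<^sub>L A $ \<beta> o\<^sub>L T (flat \<beta> (flat \<alpha> u)))) =
        - of_int (weight u) * sigma A u
        + (\<Sum>\<alpha>\<in>UNIV. endo_trace (A $ \<alpha>) * sigma A (flat \<alpha> u))"
    by (simp add: GN1 sum_subtractf)
qed

end
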